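(* Let $X$ be a bounded subset of a uniformly convex Banach space $E$. If $(a_n)$ is a sequence in $X$ such that $(\mathbf{h}_{a_n})$ converges (pointwise on $E$) to a metric functional $\mathbf{h}\in X^{\diamondsuit}$, then there exists a unique vector $a\in E$ such that $\mathbf{h}(a)\le\mathbf{h}(x)$ for all $x\in E$.
   Context: Banach spaces are real. Metric functionals: fix a base point $o\in E$. For $w\in E$ define $\mathbf{h}_w:E\to\mathbb{R}$ by $\mathbf{h}_w(x)=\|x-w\|-\|o-w\|$. Equip $\mathbb{R}^E$ (all functions $E\to\mathbb{R}$) with the topology of pointwise convergence. For a subset $X\subset E$, $X^{\diamondsuit}$ is the closure of $\{\mathbf{h}_w : w\in X\}$ in $\mathbb{R}^E$ (so its elements, called metric functionals, are functions on all of $E$). *)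

theory Defs
  imports "HOL-Analysis.Analysis"
begin

definition uniformly_convex :: "'a::real_normed_vector itself \<Rightarrow> bool" where
  "uniformly_convex _ \<longleftrightarrow>
    (\<forall>\<epsilon>. 0 < \<epsilon> \<and> \<epsilon> \<le> 2 \<longrightarrow>
      (\<exists>\<delta>>0. \<forall>x y :: 'a. norm x = 1 \<and> norm y = 1 \<and> norm (x - y) \<ge> \<epsilon> \<longrightarrow>
        norm ((1 / 2) *\<^sub>R (x + y)) \<le> 1 - \<delta>))"

text \<open>The base point is passed as the first argument.\<close>

definition internal_functional :: "'a::real_normed_vector \<Rightarrow> 'a \<Rightarrow> 'a \<Rightarrow> real" where
  "internal_functional o' w x = norm (x - w) - norm (o' - w)"

text \<open>The closure is taken in the type of all functions from \<open>'a\<close> to \<open>real\<close>, whose library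
  topology is the product topology, that is, the topology of pointwise convergence.\<close>

definition metric_functionals :: "'a::real_normed_vector \<Rightarrow> 'a set \<Rightarrow> ('a \<Rightarrow> real) set" where
  "metric_functionals o' X = closure (internal_functional o' ` X)"

end

theory Submission
  imports Defs
begin

text \<open>
  Along a subsequence \<open>c\<close> of \<open>a\<close> the bounded distances \<open>norm (o' - a n)\<close> converge, so that
  \<open>h\<close> differs by a constant from \<open>\<rho> x = lim norm (x - c n)\<close>. A minimizer of \<open>h\<close> is therefore the
  same thing as an asymptotic centre of \<open>c\<close>, and the claim becomes the classical fact that in a
  uniformly convex Banach space asymptotic centres exist and are unique.

  Both halves of that fact follow from one estimate, \<open>almost_minimizers_close\<close>: points whose
  \<open>\<rho>\<close>-value is close to \<open>r = inf \<rho>\<close> are close to each other. Indeed, if \<open>x\<close> and \<open>y\<close> are far apart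
  while almost all \<open>c n\<close> lie within a distance barely larger than \<open>r\<close> of both, uniform
  convexity puts the midpoint of \<open>x\<close> and \<open>y\<close> at distance strictly below \<open>r\<close> from almost all \<open>c n\<close>.
  Two minimizers are then at distance \<open>0\<close>; and a minimizing sequence is Cauchy, so by completeness
  it has a limit, which is a minimizer because \<open>\<rho>\<close> is continuous.
\<close>

text \<open>
  Vectors of norm close to \<open>1\<close> may be normalized at a small cost, which reduces to the unit
  sphere; and if one of the two vectors is substantially shorter than \<open>1\<close>, the triangle inequality
  alone shortens the midpoint. The threshold \<open>\<eta>\<close> separating the two cases must be small compared
  with both \<open>\<epsilon>\<close>, to keep the normalized vectors apart, and the modulus \<open>\<delta>\<close> of the sphere.
\<close>

lemma uniformly_convex_unit_ball:
  fixes \<epsilon> :: real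
  assumes uc: "uniformly_convex TYPE('a::real_normed_vector)" and \<epsilon>: "0 < \<epsilon>" "\<epsilon> \<le> 2"
  obtains \<delta> where "\<delta> > 0"
    "\<And>x y :: 'a. norm x \<le> 1 \<Longrightarrow> norm y \<le> 1 \<Longrightarrow> norm (x - y) \<ge> \<epsilon> \<Longrightarrow>
      norm ((1/2) *\<^sub>R (x + y)) \<le> 1 - \<delta>"
proof -
  have "0 < \<epsilon> / 2 \<and> \<epsilon> / 2 \<le> 2" using \<epsilon> by auto
  then obtain \<delta> where \<delta>: "\<delta> > 0"
    and sphere: "\<And>x y :: 'a. norm x = 1 \<Longrightarrow> norm y = 1 \<Longrightarrow> norm (x - y) \<ge> \<epsilon>/2 \<Longrightarrow>
      norm ((1/2) *\<^sub>R (x + y)) \<le> 1 - \<delta>"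
    using uc unfolding uniformly_convex_def by meson
  define \<eta> where "\<eta> = min (\<epsilon>/4) (\<delta>/2)"
  have \<eta>: "\<eta> > 0" "\<eta> \<le> \<epsilon>/4" "\<eta> \<le> \<delta>/2" using \<epsilon> \<delta> by (auto simp: \<eta>_def)
  have near_sphere: "norm (sgn z) = 1 \<and> norm (z - sgn z) \<le> \<eta>"
    if "norm z \<le> 1" "norm z > 1 - \<eta>" for z :: 'a
  proof -
    have nz: "norm z > 0" using that \<eta> \<epsilon> by linarith
    have "z - sgn z = (norm z - 1) *\<^sub>R sgn z"
      using nz by (simp add: sgn_div_norm algebra_simps)
    then have "norm (z - sgn z) = \<bar>norm z - 1\<bar> * norm (sgn z)" by simp
    then show ?thesis using that nz by (simp add: norm_sgn)
  qed
  show thesis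
  proof (rule that[of "\<eta>/2"])
    show "\<eta>/2 > 0" using \<eta> by simp
    fix x y :: 'a
    assume x: "norm x \<le> 1" and y: "norm y \<le> 1" and xy: "norm (x - y) \<ge> \<epsilon>"
    show "norm ((1/2) *\<^sub>R (x + y)) \<le> 1 - \<eta>/2"
    proof (cases "norm x \<le> 1 - \<eta> \<or> norm y \<le> 1 - \<eta>")
      case True
      then show ?thesis using norm_triangle_ineq[of x y] x y by auto
    next
      case False
      then have x': "norm (sgn x) = 1" "norm (x - sgn x) \<le> \<eta>"
        and y': "norm (sgn y) = 1" "norm (y - sgn y) \<le> \<eta>"
        using near_sphere x y by auto
      have "norm (x - y) \<le> norm (sgn x - sgn y) + norm (x - sgn x) + norm (y - sgn y)"
        using norm_triangle_ineq[of "sgn x - sgn y" "x - sgn x"]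
          norm_triangle_ineq4[of "(sgn x - sgn y) + (x - sgn x)" "y - sgn y"] by simp
      then have "norm (sgn x - sgn y) \<ge> \<epsilon>/2" using x' y' xy \<eta> by linarith
      then have mid: "norm (sgn x + sgn y) \<le> 2 - 2 * \<delta>"
        using sphere[of "sgn x" "sgn y"] x' y' by simp
      have "norm (x + y) \<le> norm (sgn x + sgn y) + norm (x - sgn x) + norm (y - sgn y)"
        using norm_triangle_ineq[of "sgn x + sgn y" "x - sgn x"]
          norm_triangle_ineq[of "(sgn x + sgn y) + (x - sgn x)" "y - sgn y"] by simp
      then have "norm (x + y) \<le> 2 - \<eta>" using mid x' y' \<eta> by linarith
      then show ?thesis by simp
    qed
  qed
qed

lemma uniformly_convex_ball:
  fixes \<epsilon> :: real
  assumes uc: "uniformly_convex TYPE('a::real_normed_vector)" and \<epsilon>: "0 < \<epsilon>" "\<epsilon> \<le> 2"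
  obtains \<delta> where "\<delta> > 0"
    "\<And>(x :: 'a) y s. s > 0 \<Longrightarrow> norm x \<le> s \<Longrightarrow> norm y \<le> s \<Longrightarrow> norm (x - y) \<ge> \<epsilon> * s \<Longrightarrow>
      norm ((1/2) *\<^sub>R (x + y)) \<le> (1 - \<delta>) * s"
proof -
  obtain \<delta> where \<delta>: "\<delta> > 0" and unit: "\<And>x y :: 'a. norm x \<le> 1 \<Longrightarrow> norm y \<le> 1 \<Longrightarrow>
      norm (x - y) \<ge> \<epsilon> \<Longrightarrow> norm ((1/2) *\<^sub>R (x + y)) \<le> 1 - \<delta>"
    using uniformly_convex_unit_ball[OF uc \<epsilon>] by metis
  show thesis
  proof (rule that[OF \<delta>])
    fix x y :: 'a and s :: real
    assume s: "s > 0" and x: "norm x \<le> s" and y: "norm y \<le> s" and xy: "norm (x - y) \<ge> \<epsilon> * s"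
    have "norm (x /\<^sub>R s - y /\<^sub>R s) = norm (x - y) / s"
      using s by (simp flip: scaleR_diff_right add: divide_inverse)
    then have "norm (x /\<^sub>R s - y /\<^sub>R s) \<ge> \<epsilon>"
      using s xy by (simp only: pos_le_divide_eq)
    then have "norm ((1/2) *\<^sub>R (x /\<^sub>R s + y /\<^sub>R s)) \<le> 1 - \<delta>"
      using s x y by (intro unit) (simp_all add: inverse_eq_divide)
    moreover have "(1/2) *\<^sub>R (x /\<^sub>R s + y /\<^sub>R s) = ((1/2) *\<^sub>R (x + y)) /\<^sub>R s"
      by (simp add: scaleR_add_right mult.commute)
    moreover have "norm (z /\<^sub>R s) = norm z / s" for z :: 'a
      using s by (simp add: divide_inverse mult.commute)
    ultimately have "norm ((1/2) *\<^sub>R (x + y)) / s \<le> 1 - \<delta>"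
      by (simp only:)
    then show "norm ((1/2) *\<^sub>R (x + y)) \<le> (1 - \<delta>) * s"
      using s by (simp only: pos_divide_le_eq)
  qed
qed

text \<open>
  For \<open>r = 0\<close> the triangle inequality suffices. For \<open>r > 0\<close> the midpoint argument applies to the
  vectors \<open>x - c n\<close> and \<open>y - c n\<close>, whose difference \<open>x - y\<close> does not depend on \<open>n\<close>.
\<close>

lemma almost_minimizers_close:
  fixes c :: "nat \<Rightarrow> 'a::real_normed_vector" and \<rho> :: "'a \<Rightarrow> real"
  assumes uc: "uniformly_convex TYPE('a)"
    and lim: "\<And>x. (\<lambda>n. norm (x - c n)) \<longlonglongrightarrow> \<rho> x"
    and r: "0 \<le> r" "\<And>x. r \<le> \<rho> x"
    and e: "e > 0"
  obtains t where "t > r" "\<And>x y. \<rho> x < t \<Longrightarrow> \<rho> y < t \<Longrightarrow> norm (x - y) < e"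
proof (cases "r = 0")
  case True
  have "norm (x - y) < e" if "\<rho> x < e/2" "\<rho> y < e/2" for x y
  proof -
    have "norm (x - y) \<le> norm (x - c n) + norm (y - c n)" for n
      using norm_triangle_ineq4[of "x - c n" "y - c n"] by simp
    then have "norm (x - y) \<le> \<rho> x + \<rho> y"
      by (intro LIMSEQ_le_const[OF tendsto_add[OF lim lim]]) auto
    then show ?thesis using that by linarith
  qed
  then show ?thesis using True e that[of "e/2"] by auto
next
  case False
  then have r0: "r > 0" using r by simp
  \<comment> \<open>Below, the common radius \<open>t\<close> is at most \<open>2 * r\<close>, so \<open>\<epsilon> * t \<le> e\<close>.\<close>
  define \<epsilon> where "\<epsilon> = min 2 (e / (2 * r))"
  have \<epsilon>: "0 < \<epsilon>" "\<epsilon> \<le> 2" using e r0 by (auto simp: \<epsilon>_def)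
  obtain \<delta> where \<delta>: "\<delta> > 0"
    and conv: "\<And>(x :: 'a) y s. s > 0 \<Longrightarrow> norm x \<le> s \<Longrightarrow> norm y \<le> s \<Longrightarrow> norm (x - y) \<ge> \<epsilon> * s \<Longrightarrow>
      norm ((1/2) *\<^sub>R (x + y)) \<le> (1 - \<delta>) * s"
    using uniformly_convex_ball[OF uc \<epsilon>] by metis
  \<comment> \<open>The contraction beats the enlargement of the radius, as \<open>(1 - d) * (1 + d) < 1\<close>.\<close>
  define d where "d = min \<delta> 1"
  have d: "0 < d" "d \<le> 1" "d \<le> \<delta>" using \<delta> by (auto simp: d_def)
  define t where "t = r * (1 + d)"
  have t: "r < t" "t \<le> 2 * r" using r0 d by (auto simp: t_def)
  have "(1 - \<delta>) * t \<le> (1 - d) * t" using d t r0 by (intro mult_right_mono) auto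
  also have "\<dots> = r - r * d\<^sup>2" by (simp add: t_def algebra_simps power2_eq_square)
  also have "\<dots> < r" using r0 d by simp
  finally have below: "(1 - \<delta>) * t < r" .
  have "\<epsilon> * t \<le> e / (2 * r) * (2 * r)"
    using \<epsilon> t r0 e by (intro mult_mono) (auto simp: \<epsilon>_def)
  then have \<epsilon>t: "\<epsilon> * t \<le> e" using r0 by simp
  have "norm (x - y) < e" if "\<rho> x < t" "\<rho> y < t" for x y
  proof (rule ccontr)
    assume "\<not> norm (x - y) < e"
    then have far: "norm (x - y) \<ge> \<epsilon> * t" using \<epsilon>t by linarith
    define m where "m = (1/2) *\<^sub>R (x + y)"
    have "\<forall>\<^sub>F n in sequentially. norm (x - c n) < t" "\<forall>\<^sub>F n in sequentially. norm (y - c n) < t"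
      using order_tendstoD(2)[OF lim] that by auto
    then have "\<forall>\<^sub>F n in sequentially. norm (m - c n) \<le> (1 - \<delta>) * t"
    proof eventually_elim
      case (elim n)
      have "(1/2::real) *\<^sub>R (c n + c n) = c n" by (simp flip: scaleR_2)
      then have "m - c n = (1/2) *\<^sub>R ((x - c n) + (y - c n))"
        by (simp add: m_def algebra_simps)
      then show ?case using conv[of t "x - c n" "y - c n"] elim far t r0 by simp
    qed
    then have "\<rho> m \<le> (1 - \<delta>) * t"
      using tendsto_upperbound[OF lim] by simp
    then show False using below r(2)[of m] by linarith
  qed
  then show ?thesis using that t(1) by blast
qed

theorem asymptotic_centre_exists_unique:
  fixes c :: "nat \<Rightarrow> 'a::banach" and \<rho> :: "'a \<Rightarrow> real"
  assumes uc: "uniformly_convex TYPE('a)"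
    and lim: "\<And>x. (\<lambda>n. norm (x - c n)) \<longlonglongrightarrow> \<rho> x"
  shows "\<exists>!b. \<forall>x. \<rho> b \<le> \<rho> x"
proof -
  define r where "r = Inf (range \<rho>)"
  have nonneg: "0 \<le> \<rho> x" for x by (rule LIMSEQ_le_const[OF lim]) auto
  have "bdd_below (range \<rho>)" using nonneg by (intro bdd_belowI2)
  then have r_le: "r \<le> \<rho> x" for x unfolding r_def by (rule cINF_lower) simp
  have r0: "0 \<le> r" unfolding r_def using nonneg by (intro cINF_greatest) auto
  note close = almost_minimizers_close[OF uc lim r0 r_le]
  have approx: "\<exists>x. \<rho> x < u" if "u > r" for u
    using that cInf_lessD[of "range \<rho>" u] unfolding r_def by auto
  have lipschitz: "\<bar>\<rho> x - \<rho> y\<bar> \<le> norm (x - y)" for x y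
  proof (rule LIMSEQ_le_const2)
    show "(\<lambda>n. \<bar>norm (x - c n) - norm (y - c n)\<bar>) \<longlonglongrightarrow> \<bar>\<rho> x - \<rho> y\<bar>"
      by (intro tendsto_intros lim)
    have "\<bar>norm (x - c n) - norm (y - c n)\<bar> \<le> norm (x - y)" for n
      using norm_triangle_ineq3[of "x - c n" "y - c n"] by simp
    then show "\<exists>N. \<forall>n\<ge>N. \<bar>norm (x - c n) - norm (y - c n)\<bar> \<le> norm (x - y)" by blast
  qed
  obtain z where z: "\<And>n. \<rho> (z n) < r + inverse (real (Suc n))"
    using approx[of "r + inverse (real (Suc _))"] by (simp del: of_nat_Suc) metis
  have \<rho>z: "(\<lambda>n. \<rho> (z n)) \<longlonglongrightarrow> r"
  proof (rule tendsto_sandwich[OF _ _ tendsto_const])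
    show "(\<lambda>n. r + inverse (real (Suc n))) \<longlonglongrightarrow> r"
      using LIMSEQ_inverse_real_of_nat_add .
  qed (use r_le less_imp_le[OF z] in \<open>auto intro!: always_eventually simp del: of_nat_Suc\<close>)
  have "Cauchy z"
  proof (rule CauchyI)
    fix e :: real assume "e > 0"
    then obtain t where "t > r" and t: "\<And>x y. \<rho> x < t \<Longrightarrow> \<rho> y < t \<Longrightarrow> norm (x - y) < e"
      using close by metis
    then obtain N where "\<And>n. n \<ge> N \<Longrightarrow> \<rho> (z n) < t"
      using order_tendstoD(2)[OF \<rho>z] unfolding eventually_sequentially by blast
    then show "\<exists>N. \<forall>m\<ge>N. \<forall>n\<ge>N. norm (z m - z n) < e" using t by blast
  qed
  then obtain b where b: "z \<longlonglongrightarrow> b" using Cauchy_convergent convergent_def by blast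
  have "(\<lambda>n. norm (z n - b)) \<longlonglongrightarrow> 0" using b by (simp add: LIM_zero tendsto_norm_zero)
  then have "(\<lambda>n. \<rho> (z n) - \<rho> b) \<longlonglongrightarrow> 0"
    by (rule Lim_null_comparison[rotated]) (simp add: lipschitz)
  then have "(\<lambda>n. \<rho> (z n)) \<longlonglongrightarrow> \<rho> b" by (simp add: LIM_zero_iff)
  then have \<rho>b: "\<rho> b = r" using LIMSEQ_unique \<rho>z by blast
  show ?thesis
  proof (rule ex1I[of _ b])
    show "\<forall>x. \<rho> b \<le> \<rho> x" using \<rho>b r_le by simp
    fix b' assume "\<forall>x. \<rho> b' \<le> \<rho> x"
    then have \<rho>b': "\<rho> b' = r" using \<rho>b r_le by (metis order_antisym)
    have "norm (b' - b) \<le> 0"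
    proof (rule field_le_epsilon)
      fix e :: real assume "e > 0"
      then show "norm (b' - b) \<le> 0 + e" using close \<rho>b \<rho>b' by (metis add_0 less_imp_le)
    qed
    then show "b' = b" by simp
  qed
qed

theorem proposition4p25:
  fixes o' :: "'a::banach"
    and X :: "'a set"
    and a :: "nat \<Rightarrow> 'a"
    and h :: "'a \<Rightarrow> real"
  assumes "uniformly_convex TYPE('a)"
    and "bounded X"
    and "\<And>n. a n \<in> X"
    and "h \<in> metric_functionals o' X"
    and "\<And>x. (\<lambda>n. internal_functional o' (a n) x) \<longlonglongrightarrow> h x"
  shows "\<exists>!b. \<forall>x. h b \<le> h x"
proof -
  obtain B where "\<And>x. x \<in> X \<Longrightarrow> norm x \<le> B" using assms(2) by (auto simp: bounded_iff)
  then have "norm (norm (o' - a n)) \<le> norm o' + B" for n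
    using norm_triangle_ineq4[of o' "a n"] assms(3)[of n] by fastforce
  then have "bounded (range (\<lambda>n. norm (o' - a n)))" by (auto simp: bounded_iff)
  then obtain l k where k: "strict_mono k"
    and l: "((\<lambda>n. norm (o' - a n)) \<circ> k) \<longlonglongrightarrow> l"
    using bounded_imp_convergent_subsequence by metis
  have "(\<lambda>n. norm (x - a (k n))) \<longlonglongrightarrow> h x + l" for x
    using tendsto_add[OF LIMSEQ_subseq_LIMSEQ[OF assms(5) k] l]
    by (simp add: internal_functional_def o_def)
  then have "\<exists>!b. \<forall>x. h b + l \<le> h x + l"
    by (rule asymptotic_centre_exists_unique[OF assms(1)])
  then show ?thesis by simp
qed

end
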